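(* For every integer $n\geq 8$ there exists an almost 2-perfect (A2P) maximum 8-cycle packing of $K_n$.
   Context: An 8-cycle packing of $K_n$ on an $n$-element vertex set $\mathcal{X}$ is a triple $(\mathcal{X},\mathcal{C},\mathcal{L})$ where $\mathcal{C}$ is a collection of pairwise edge-disjoint 8-cycles of $K_n$ and the leave $\mathcal{L}$ is the set of edges of $K_n$ lying in no cycle of $\mathcal{C}$. It is a maximum packing if $|\mathcal{L}|$ is as small as possible among all 8-cycle packings of $K_n$. For an 8-cycle $C$, an inside 8-cycle of $C$ is an 8-cycle on the same vertex set as $C$ sharing no edge with $C$. The packing $(\mathcal{X},\mathcal{C},\mathcal{L})$ is almost 2-perfect (A2P) if one can choose, for each $C\in\mathcal{C}$, an inside 8-cycle $C'$ of $C$ such that the chosen cycles $\mathcal{C}'=\{C'\}$ are pairwise edge-disjoint and contain no edge of $\mathcal{L}$, i.e. $(\mathcal{X},\mathcal{C}',\mathcal{L})$ is again an 8-cycle packing of $K_n$ with the same leave. *)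

theory Defs
  imports Main
begin

definition complete_edges :: "'a set \<Rightarrow> 'a set set" where
  "complete_edges X = {e. e \<subseteq> X \<and> card e = 2}"

definition is_8cycle :: "'a set set \<Rightarrow> bool" where
  "is_8cycle C \<longleftrightarrow> (\<exists>v :: nat \<Rightarrow> 'a. inj_on v {0..<8} \<and>
      C = {{v i, v ((i + 1) mod 8)} | i. i < 8})"

definition cycle_vertices :: "'a set set \<Rightarrow> 'a set" where
  "cycle_vertices C = \<Union>C"

definition is_8cycle_packing :: "'a set \<Rightarrow> 'a set set set \<Rightarrow> 'a set set \<Rightarrow> bool" where
  "is_8cycle_packing X CC L \<longleftrightarrow>
     (\<forall>C\<in>CC. is_8cycle C \<and> C \<subseteq> complete_edges X) \<and>
     (\<forall>C1\<in>CC. \<forall>C2\<in>CC. C1 \<noteq> C2 \<longrightarrow> C1 \<inter> C2 = {}) \<and>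
     L = complete_edges X - \<Union>CC"

definition is_max_8cycle_packing :: "'a set \<Rightarrow> 'a set set set \<Rightarrow> 'a set set \<Rightarrow> bool" where
  "is_max_8cycle_packing X CC L \<longleftrightarrow>
     is_8cycle_packing X CC L \<and>
     (\<forall>CC' L'. is_8cycle_packing X CC' L' \<longrightarrow> card L \<le> card L')"

definition is_inside_8cycle :: "'a set set \<Rightarrow> 'a set set \<Rightarrow> bool" where
  "is_inside_8cycle C C' \<longleftrightarrow> is_8cycle C' \<and> cycle_vertices C' = cycle_vertices C \<and> C' \<inter> C = {}"

definition is_A2P :: "'a set \<Rightarrow> 'a set set set \<Rightarrow> 'a set set \<Rightarrow> bool" where
  "is_A2P X CC L \<longleftrightarrow> is_8cycle_packing X CC L \<and>
     (\<exists>f. (\<forall>C\<in>CC. is_inside_8cycle C (f C)) \<and>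
          (\<forall>C1\<in>CC. \<forall>C2\<in>CC. C1 \<noteq> C2 \<longrightarrow> f C1 \<inter> f C2 = {}) \<and>
          (\<forall>C\<in>CC. f C \<inter> L = {}) \<and>
          is_8cycle_packing X (f ` CC) L)"

end

theory Submission
  imports Defs "HOL-Library.Code_Binary_Nat" "HOL-Library.Disjoint_Sets" "HOL-Library.Product_Lexorder"
begin

text \<open>
  Packings with inside cycles can be glued along an edge-disjoint union of graphs.
  The complement of an 8-cycle in \<open>K\<^sub>4\<^sub>,\<^sub>4\<close> is again an 8-cycle, which leads to decompositions of
  \<open>K\<^sub>p\<^sub>,\<^sub>q\<close> with empty leave whenever \<open>p, q \<ge> 4\<close> are even and \<open>8\<close> divides \<open>p q\<close>.
  For even \<open>n\<close>, adding a copy of \<open>K\<^sub>8\<close> whose leave is a perfect matching enlarges the leave by 4 edges.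
  For odd \<open>n\<close>, adding 16 points and a decomposition of \<open>K\<^sub>1\<^sub>7\<close> on these and one old point does not
  change the leave. Most initial values come from computer-found packings, nearly all of them with a
  cyclic symmetry. The values 12 and 14 arise from 8 and 10 by adding a completely uncovered
  \<open>K\<^sub>4\<close>, and 15 and 23 from 9 and 17 by adding 6 points with a packing of \<open>K\<^sub>1\<^sub>1\<close> minus \<open>K\<^sub>5\<close>
  whose leave is a pentagon.

  The packings are maximum because the size of the leave is fixed modulo 8 and its degrees have the
  parity of \<open>n - 1\<close>: for even \<open>n\<close> it has at least \<open>n / 2\<close> edges, for odd \<open>n\<close> it cannot have
  1 or 2 edges.
\<close>

section \<open>Cycles and inside cycles\<close>

lemma is_8cycleI:
  assumes "inj_on v {..<8}"
  shows "is_8cycle ((\<lambda>i. {v i, v ((i + 1) mod 8)}) ` {..<8::nat})"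
  using assms unfolding is_8cycle_def by (auto simp: atLeast0LessThan)

lemma is_8cycleE:
  assumes "is_8cycle C"
  obtains v where "inj_on v {..<8}" "C = (\<lambda>i. {v i, v ((i + 1) mod 8)}) ` {..<8::nat}"
proof -
  obtain v :: "nat \<Rightarrow> 'a" where "inj_on v {0..<8}" "C = {{v i, v ((i + 1) mod 8)} | i. i < 8}"
    using assms unfolding is_8cycle_def by blast
  then show thesis by (intro that[of v]) (auto simp: atLeast0LessThan)
qed

lemma is_8cycle_nonempty: "is_8cycle C \<Longrightarrow> C \<noteq> {}"
  by (rule is_8cycleE) (auto simp: lessThan_empty_iff)

lemma card_edge_8cycle:
  assumes "is_8cycle C" "e \<in> C"
  shows "card e = 2"
proof -
  obtain v where v: "inj_on v {..<8}" "C = (\<lambda>i. {v i, v ((i + 1) mod 8)}) ` {..<8::nat}"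
    using assms(1) by (rule is_8cycleE)
  then obtain i where i: "i < 8" "e = {v i, v ((i + 1) mod 8)}" using assms(2) by auto
  then have "i \<noteq> (i + 1) mod 8" by (auto simp: mod_Suc)
  then have "v i \<noteq> v ((i + 1) mod 8)" using v(1) i(1) by (auto dest: inj_onD)
  then show ?thesis using i(2) by simp
qed

lemma is_8cycle_image:
  assumes "is_8cycle C" and h: "inj_on h (\<Union>C)"
  shows "is_8cycle ((`) h ` C)"
proof -
  obtain v where v: "inj_on v {..<8}" "C = (\<lambda>i. {v i, v ((i + 1) mod 8)}) ` {..<8::nat}"
    using assms(1) by (rule is_8cycleE)
  have "v ` {..<8} \<subseteq> \<Union>C" using v(2) by auto
  then have "inj_on (h \<circ> v) {..<8}" using v(1) h by (meson comp_inj_on inj_on_subset)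
  moreover have "(`) h ` C = (\<lambda>i. {(h \<circ> v) i, (h \<circ> v) ((i + 1) mod 8)}) ` {..<8}"
    unfolding v(2) by (simp add: image_image)
  ultimately show ?thesis using is_8cycleI[of "h \<circ> v"] by (simp only:)
qed

lemma is_inside_8cycle_image:
  assumes "is_inside_8cycle C C'" and h: "inj_on h (\<Union>C)"
  shows "is_inside_8cycle ((`) h ` C) ((`) h ` C')"
proof -
  have C': "is_8cycle C'" "\<Union>C' = \<Union>C" "C' \<inter> C = {}"
    using assms(1) unfolding is_inside_8cycle_def cycle_vertices_def by auto
  have "inj_on ((`) h) (C' \<union> C)" using h C'(2) by (simp add: inj_on_image)
  then have "(`) h ` C' \<inter> (`) h ` C = (`) h ` (C' \<inter> C)" by (simp add: inj_on_image_Int)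
  moreover have "\<Union>((`) h ` C') = \<Union>((`) h ` C)" using C'(2) by (metis image_Union)
  moreover have "is_8cycle ((`) h ` C')" using C' h by (simp add: is_8cycle_image)
  ultimately show ?thesis
    using C'(3) unfolding is_inside_8cycle_def cycle_vertices_def by simp
qed

section \<open>Simultaneous decompositions and packings of graphs\<close>

text \<open>
  Following two graphs at once lets a packing be built cycle by cycle: the inside cycles cover the
  same edges as the cycles only at the end.
\<close>

inductive inside_decomposition :: "'a set set \<Rightarrow> 'a set set \<Rightarrow> bool" where
  empty: "inside_decomposition {} {}"
| cycle: "inside_decomposition (C \<union> G) (C' \<union> G')"
  if "is_8cycle C" "is_inside_8cycle C C'" "C \<inter> G = {}" "C' \<inter> G' = {}"
    "inside_decomposition G G'"

lemma inside_decomposition_Un: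
  assumes "inside_decomposition G G'" "inside_decomposition H H'" "G \<inter> H = {}" "G' \<inter> H' = {}"
  shows "inside_decomposition (G \<union> H) (G' \<union> H')"
  using assms
proof induction
  case empty
  then show ?case by simp
next
  case (cycle C C' G G')
  then have "inside_decomposition (C \<union> (G \<union> H)) (C' \<union> (G' \<union> H'))"
    by (intro inside_decomposition.cycle[of C C' "G \<union> H" "G' \<union> H'"]) auto
  then show ?case by (simp add: Un_assoc)
qed

lemma inside_decomposition_UN:
  assumes "finite I" "\<And>i. i \<in> I \<Longrightarrow> inside_decomposition (G i) (G' i)"
    and "disjoint_family_on G I" "disjoint_family_on G' I"
  shows "inside_decomposition (\<Union>i\<in>I. G i) (\<Union>i\<in>I. G' i)"
  using assms
proof (induction I)
  case empty
  show ?case by (simp add: inside_decomposition.empty)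
next
  case (insert i I)
  then have "G i \<inter> (\<Union>j\<in>I. G j) = {}" "G' i \<inter> (\<Union>j\<in>I. G' j) = {}"
    and "inside_decomposition (\<Union>j\<in>I. G j) (\<Union>j\<in>I. G' j)"
    by (auto simp: disjoint_family_on_insert)
  then show ?case using insert.prems(1) by (simp add: inside_decomposition_Un)
qed

lemma inside_decomposition_image:
  assumes "inside_decomposition G G'" "inj_on h A" "\<Union>G \<subseteq> A" "\<Union>G' \<subseteq> A"
  shows "inside_decomposition ((`) h ` G) ((`) h ` G')"
  using assms
proof induction
  case empty
  show ?case by (simp add: inside_decomposition.empty)
next
  case (cycle C C' G G')
  have h: "inj_on h (\<Union>E)" if "\<Union>E \<subseteq> A" for E
    using cycle.prems(1) that by (rule inj_on_subset)
  have disjoint: "(`) h ` E \<inter> (`) h ` F = {}" if "E \<inter> F = {}" "\<Union>(E \<union> F) \<subseteq> A" for E F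
    using inj_on_image_Int[OF inj_on_image[OF h[OF that(2)]] Un_upper1 Un_upper2] that(1) by simp
  have "inside_decomposition ((`) h ` G) ((`) h ` G')"
    using cycle.prems by (intro cycle.IH) auto
  then show ?case
    unfolding image_Un using cycle.hyps(1-4) cycle.prems(2,3)
    by (intro inside_decomposition.cycle is_8cycle_image is_inside_8cycle_image disjoint h) auto
qed

lemma inside_decomposition_imp_assignment:
  assumes "inside_decomposition G G'"
  obtains CC f where
    "\<And>C. C \<in> CC \<Longrightarrow> is_8cycle C \<and> is_inside_8cycle C (f C)"
    "pairwise (\<lambda>C D. C \<inter> D = {} \<and> f C \<inter> f D = {}) CC"
    "\<Union>CC = G" "\<Union>(f ` CC) = G'"
  using assms
proof (induction arbitrary: thesis)
  case empty
  show ?case by (rule empty[of "{}" undefined]) simp_all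
next
  case (cycle C C' G G')
  obtain CC f where cycles: "\<And>D. D \<in> CC \<Longrightarrow> is_8cycle D \<and> is_inside_8cycle D (f D)"
    and disjoint: "pairwise (\<lambda>C D. C \<inter> D = {} \<and> f C \<inter> f D = {}) CC"
    and Union: "\<Union>CC = G" "\<Union>(f ` CC) = G'"
    using cycle.IH by blast
  have fresh: "C \<notin> CC"
    using is_8cycle_nonempty[OF cycle.hyps(1)] cycle.hyps(3) Union(1) by blast
  show ?case
  proof (rule cycle.prems)
    show "is_8cycle D \<and> is_inside_8cycle D ((f(C := C')) D)" if "D \<in> insert C CC" for D
      using that cycle.hyps cycles by auto
    have "D \<noteq> C" "C \<inter> D = {}" "D \<inter> C = {}" "C' \<inter> f D = {}" "f D \<inter> C' = {}" if "D \<in> CC" for D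
      using that fresh Union cycle.hyps(3,4) by auto
    then show "pairwise (\<lambda>D D'. D \<inter> D' = {} \<and> (f(C := C')) D \<inter> (f(C := C')) D' = {}) (insert C CC)"
      using disjoint by (auto simp: pairwise_insert pairwise_def)
    show "\<Union>(insert C CC) = C \<union> G" "\<Union>(f(C := C') ` insert C CC) = C' \<union> G'"
      using Union fresh by auto
  qed
qed

definition a2p_packable :: "'a set set \<Rightarrow> nat \<Rightarrow> bool" where
  "a2p_packable E l \<longleftrightarrow>
     (\<exists>L\<subseteq>E. finite L \<and> card L = l \<and> inside_decomposition (E - L) (E - L))"

lemma a2p_packable_if_inside_decomposition:
  assumes "inside_decomposition G G" "G \<subseteq> E" "finite E" "card E = card G + l"
  shows "a2p_packable E l"
  unfolding a2p_packable_def
  using assms by (intro exI[of _ "E - G"]) (simp add: double_diff card_Diff_subset finite_subset)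

lemma a2p_packable_card: "finite E \<Longrightarrow> a2p_packable E (card E)"
  using inside_decomposition.empty by (rule a2p_packable_if_inside_decomposition) simp_all

lemma a2p_packable_Un:
  assumes "a2p_packable E l" "a2p_packable F m" and EF: "E \<inter> F = {}"
  shows "a2p_packable (E \<union> F) (l + m)"
proof -
  obtain L where L: "L \<subseteq> E" "finite L" "card L = l" "inside_decomposition (E - L) (E - L)"
    using assms(1) unfolding a2p_packable_def by blast
  obtain M where M: "M \<subseteq> F" "finite M" "card M = m" "inside_decomposition (F - M) (F - M)"
    using assms(2) unfolding a2p_packable_def by blast
  have "E \<union> F - (L \<union> M) = (E - L) \<union> (F - M)" using L(1) M(1) EF by blast
  then have "inside_decomposition (E \<union> F - (L \<union> M)) (E \<union> F - (L \<union> M))"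
    using inside_decomposition_Un[OF L(4) M(4)] EF by auto
  moreover have "card (L \<union> M) = l + m"
    using L(1-3) M(1-3) EF by (subst card_Un_disjoint) auto
  ultimately show ?thesis
    unfolding a2p_packable_def using L(1,2) M(1,2) by (intro exI[of _ "L \<union> M"]) auto
qed

lemma a2p_packable_image:
  assumes "a2p_packable E l" and h: "inj_on h (\<Union>E)"
  shows "a2p_packable ((`) h ` E) l"
proof -
  obtain L where L: "L \<subseteq> E" "finite L" "card L = l" "inside_decomposition (E - L) (E - L)"
    using assms(1) unfolding a2p_packable_def by blast
  have h_edges: "inj_on ((`) h) E" using h by (rule inj_on_image)
  have "inside_decomposition ((`) h ` (E - L)) ((`) h ` (E - L))"
    using L(4) h by (rule inside_decomposition_image) auto
  moreover have "(`) h ` (E - L) = (`) h ` E - (`) h ` L"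
    using inj_on_image_set_diff[OF h_edges _ L(1)] by simp
  moreover have "card ((`) h ` L) = l"
    using L(1,3) h_edges by (simp add: card_image inj_on_subset)
  ultimately show ?thesis
    unfolding a2p_packable_def using L(1,2) by (intro exI[of _ "(`) h ` L"]) auto
qed

lemma is_8cycle_packingI:
  assumes "\<And>C. C \<in> CC \<Longrightarrow> is_8cycle C" "pairwise disjnt CC"
    and "\<Union>CC = complete_edges X - L" "L \<subseteq> complete_edges X"
  shows "is_8cycle_packing X CC L"
  unfolding is_8cycle_packing_def
proof (intro conjI ballI impI)
  fix C assume "C \<in> CC"
  then show "is_8cycle C" "C \<subseteq> complete_edges X" using assms(1,3) by blast+
next
  fix C D assume "C \<in> CC" "D \<in> CC" "C \<noteq> D"
  then show "C \<inter> D = {}" using assms(2) by (simp add: pairwise_def disjnt_def)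
next
  show "L = complete_edges X - \<Union>CC" using assms(3,4) by blast
qed

lemma a2p_packable_imp_is_A2P:
  assumes "a2p_packable (complete_edges X) l"
  obtains CC L where "is_A2P X CC L" "card L = l"
proof -
  obtain L where L: "L \<subseteq> complete_edges X" "card L = l"
    and decomposition: "inside_decomposition (complete_edges X - L) (complete_edges X - L)"
    using assms unfolding a2p_packable_def by blast
  obtain CC f where cycles: "\<And>C. C \<in> CC \<Longrightarrow> is_8cycle C \<and> is_inside_8cycle C (f C)"
    and disjoint: "pairwise (\<lambda>C D. C \<inter> D = {} \<and> f C \<inter> f D = {}) CC"
    and Union: "\<Union>CC = complete_edges X - L" "\<Union>(f ` CC) = complete_edges X - L"
    using decomposition by (rule inside_decomposition_imp_assignment) blast
  have "is_8cycle_packing X CC L"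
    using cycles disjoint Union(1) L(1)
    by (intro is_8cycle_packingI) (auto simp: pairwise_def disjnt_def)
  moreover have "is_8cycle_packing X (f ` CC) L"
  proof (rule is_8cycle_packingI)
    show "pairwise disjnt (f ` CC)"
      using disjoint unfolding pairwise_image by (simp add: pairwise_def disjnt_def)
    show "is_8cycle C'" if "C' \<in> f ` CC" for C'
      using that cycles unfolding is_inside_8cycle_def by blast
  qed fact+
  moreover have "\<forall>C\<in>CC. f C \<inter> L = {}" using Union(2) by blast
  ultimately have "is_A2P X CC L"
    unfolding is_A2P_def using cycles disjoint
    by (intro conjI exI[of _ f]) (simp_all add: pairwise_def)
  then show thesis using L(2) that by blast
qed

section \<open>Complete and complete bipartite graphs\<close>

definition bipartite_edges :: "'a set \<Rightarrow> 'a set \<Rightarrow> 'a set set" where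
  "bipartite_edges A B = (\<lambda>(a, b). {a, b}) ` (A \<times> B)"

lemma doubleton_in_bipartite_edges:
  "{a, b} \<in> bipartite_edges A B \<longleftrightarrow> a \<in> A \<and> b \<in> B \<or> a \<in> B \<and> b \<in> A"
  unfolding bipartite_edges_def by (auto simp: doubleton_eq_iff)

lemma in_bipartite_edgesE:
  assumes "e \<in> bipartite_edges A B"
  obtains a b where "e = {a, b}" "a \<in> A" "b \<in> B"
  using assms unfolding bipartite_edges_def by auto

lemma bipartite_edges_commute: "bipartite_edges A B = bipartite_edges B A"
  by (auto elim!: in_bipartite_edgesE simp: doubleton_in_bipartite_edges)

lemma bipartite_edges_Un_right:
  "bipartite_edges A (B \<union> C) = bipartite_edges A B \<union> bipartite_edges A C"
  unfolding bipartite_edges_def by auto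

lemma bipartite_edges_image: "(`) h ` bipartite_edges A B = bipartite_edges (h ` A) (h ` B)"
  unfolding bipartite_edges_def map_prod_surj_on[OF refl refl, symmetric] image_image
  by (rule image_cong) auto

lemma card_bipartite_edges:
  assumes "A \<inter> B = {}"
  shows "card (bipartite_edges A B) = card A * card B"
proof -
  have "inj_on (\<lambda>(a, b). {a, b}) (A \<times> B)"
    using assms by (auto simp: inj_on_def doubleton_eq_iff)
  then show ?thesis by (simp add: bipartite_edges_def card_image card_cartesian_product)
qed

lemma doubleton_in_complete_edges: "{a, b} \<in> complete_edges X \<longleftrightarrow> a \<in> X \<and> b \<in> X \<and> a \<noteq> b"
  unfolding complete_edges_def by (auto simp: card_insert_if)

lemma in_complete_edgesE:
  assumes "e \<in> complete_edges X"
  obtains a b where "e = {a, b}" "a \<in> X" "b \<in> X" "a \<noteq> b"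
  using assms unfolding complete_edges_def by (auto simp: card_2_iff)

lemma finite_complete_edges: "finite X \<Longrightarrow> finite (complete_edges X)"
  unfolding complete_edges_def by (rule finite_subset[of _ "Pow X"]) auto

lemma card_complete_edges: "finite X \<Longrightarrow> card (complete_edges X) = card X choose 2"
  unfolding complete_edges_def by (rule n_subsets)

lemma complete_edges_image:
  assumes "inj_on h X"
  shows "(`) h ` complete_edges X = complete_edges (h ` X)"
proof
  show "(`) h ` complete_edges X \<subseteq> complete_edges (h ` X)"
    using assms unfolding complete_edges_def by (auto simp: card_image inj_on_subset)
  show "complete_edges (h ` X) \<subseteq> (`) h ` complete_edges X"
  proof
    fix e assume "e \<in> complete_edges (h ` X)"
    then obtain a b where "e = h ` {a, b}" "{a, b} \<in> complete_edges X"
      by (auto elim!: in_complete_edgesE simp: doubleton_in_complete_edges)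
    then show "e \<in> (`) h ` complete_edges X" by blast
  qed
qed

lemma complete_edges_mono: "X \<subseteq> Y \<Longrightarrow> complete_edges X \<subseteq> complete_edges Y"
  unfolding complete_edges_def by auto

lemma complete_edges_Int: "complete_edges (X \<inter> Y) = complete_edges X \<inter> complete_edges Y"
  unfolding complete_edges_def by auto

lemma complete_edges_Un:
  "complete_edges (X \<union> Y) =
     complete_edges X \<union> (complete_edges Y - complete_edges (X \<inter> Y)) \<union> bipartite_edges (X - Y) (Y - X)"
  (is "_ = ?R")
proof
  show "complete_edges (X \<union> Y) \<subseteq> ?R"
  proof
    fix e assume "e \<in> complete_edges (X \<union> Y)"
    then obtain a b where "e = {a, b}" "a \<in> X \<union> Y" "b \<in> X \<union> Y" "a \<noteq> b"
      by (rule in_complete_edgesE)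
    then show "e \<in> ?R"
      by (simp add: doubleton_in_complete_edges doubleton_in_bipartite_edges) blast
  qed
  have "bipartite_edges (X - Y) (Y - X) \<subseteq> complete_edges (X \<union> Y)"
    by (auto elim!: in_bipartite_edgesE simp: doubleton_in_complete_edges)
  then show "?R \<subseteq> complete_edges (X \<union> Y)"
    using complete_edges_mono[of X "X \<union> Y"] complete_edges_mono[of Y "X \<union> Y"] by blast
qed

lemma complete_edges_empty [simp]: "complete_edges {} = {}"
  by (auto elim: in_complete_edgesE)

lemma complete_edges_singleton [simp]: "complete_edges {x} = {}"
  by (auto elim: in_complete_edgesE)

lemma a2p_packable_complete_edges_Un:
  assumes "a2p_packable (complete_edges X) l"
    and "a2p_packable (complete_edges Y - complete_edges (X \<inter> Y)) m"
    and "a2p_packable (bipartite_edges (X - Y) (Y - X)) 0"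
  shows "a2p_packable (complete_edges (X \<union> Y)) (l + m)"
proof -
  have "complete_edges X \<inter> (complete_edges Y - complete_edges (X \<inter> Y)) = {}"
    by (auto simp: complete_edges_Int)
  moreover have "(complete_edges X \<union> (complete_edges Y - complete_edges (X \<inter> Y))) \<inter>
      bipartite_edges (X - Y) (Y - X) = {}"
    by (auto elim!: in_bipartite_edgesE simp: doubleton_in_complete_edges)
  ultimately have "a2p_packable (complete_edges (X \<union> Y)) (l + m + 0)"
    unfolding complete_edges_Un using assms by (intro a2p_packable_Un)
  then show ?thesis by simp
qed

section \<open>Certificates\<close>

definition cycle_edges :: "'a list \<Rightarrow> 'a set list" where
  "cycle_edges xs = map2 (\<lambda>x y. {x, y}) xs (rotate1 xs)"

lemma length_cycle_edges [simp]: "length (cycle_edges xs) = length xs"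
  by (simp add: cycle_edges_def)

lemma set_cycle_edges:
  assumes "length xs = 8"
  shows "set (cycle_edges xs) = (\<lambda>i. {xs ! i, xs ! ((i + 1) mod 8)}) ` {..<8}"
proof -
  have "set (cycle_edges xs) = (\<lambda>i. cycle_edges xs ! i) ` {..<8}"
    using assms by (auto simp: set_conv_nth)
  moreover have "cycle_edges xs ! i = {xs ! i, xs ! ((i + 1) mod 8)}" if "i < 8" for i
    using that assms by (simp add: cycle_edges_def nth_rotate1)
  ultimately show ?thesis by simp
qed

lemma is_8cycle_cycle_edges:
  assumes "length xs = 8" "distinct xs"
  shows "is_8cycle (set (cycle_edges xs))"
  unfolding set_cycle_edges[OF assms(1)]
  using assms by (intro is_8cycleI) (simp add: inj_on_nth)

lemma Union_cycle_edges:
  assumes "length xs = 8"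
  shows "\<Union>(set (cycle_edges xs)) = set xs"
  unfolding set_cycle_edges[OF assms] using assms by (auto simp: set_conv_nth)

definition inside_pair :: "'a list \<Rightarrow> 'a list \<Rightarrow> bool" where
  "inside_pair xs ys \<longleftrightarrow> length xs = 8 \<and> length ys = 8 \<and> distinct xs \<and> distinct ys \<and>
     set ys \<subseteq> set xs \<and> (\<forall>e\<in>set (cycle_edges ys). e \<notin> set (cycle_edges xs))"

lemma inside_pair_imp_is_inside_8cycle:
  assumes "inside_pair xs ys"
  shows "is_inside_8cycle (set (cycle_edges xs)) (set (cycle_edges ys))"
proof -
  have vertices: "length xs = 8" "length ys = 8" "distinct xs" "distinct ys" "set ys \<subseteq> set xs"
    and disjoint: "set (cycle_edges ys) \<inter> set (cycle_edges xs) = {}"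
    using assms unfolding inside_pair_def by auto
  then have "set ys = set xs" by (metis List.finite_set card_subset_eq distinct_card)
  then show ?thesis
    unfolding is_inside_8cycle_def cycle_vertices_def
    using vertices disjoint by (simp add: is_8cycle_cycle_edges Union_cycle_edges)
qed

definition edges_of :: "'a list list \<Rightarrow> 'a set list" where
  "edges_of xss = concat (map cycle_edges xss)"

lemma length_edges_of_inside_pairs:
  assumes "\<forall>(xs, ys)\<in>set ps. inside_pair xs ys"
  shows "length (edges_of (map fst ps)) = 8 * length ps" "length (edges_of (map snd ps)) = 8 * length ps"
  using assms by (induction ps) (auto simp: edges_of_def inside_pair_def)

lemma card_edge_of_inside_pairs:
  assumes "\<forall>(xs, ys)\<in>set ps. inside_pair xs ys" "e \<in> set (edges_of (map fst ps @ map snd ps))"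
  shows "card e = 2"
proof -
  obtain zs where "zs \<in> fst ` set ps \<union> snd ` set ps" "e \<in> set (cycle_edges zs)"
    using assms(2) by (auto simp: edges_of_def)
  moreover from this have "length zs = 8" "distinct zs"
    using assms(1) by (auto simp: inside_pair_def)
  ultimately show ?thesis using is_8cycle_cycle_edges card_edge_8cycle by blast
qed

lemma inside_decomposition_edges_of:
  assumes "\<forall>(xs, ys)\<in>set ps. inside_pair xs ys"
    and "distinct (edges_of (map fst ps))" "distinct (edges_of (map snd ps))"
  shows "inside_decomposition (set (edges_of (map fst ps))) (set (edges_of (map snd ps)))"
  using assms
proof (induction ps)
  case Nil
  show ?case by (simp add: edges_of_def inside_decomposition.empty)
next
  case (Cons p ps)
  obtain xs ys where p: "p = (xs, ys)" by fastforce
  have "inside_pair xs ys" using Cons.prems(1) p by simp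
  then have "is_8cycle (set (cycle_edges xs))"
    "is_inside_8cycle (set (cycle_edges xs)) (set (cycle_edges ys))"
    by (simp_all add: inside_pair_def is_8cycle_cycle_edges inside_pair_imp_is_inside_8cycle)
  moreover have "inside_decomposition (set (edges_of (map fst ps))) (set (edges_of (map snd ps)))"
    using Cons.prems by (intro Cons.IH) (simp_all add: edges_of_def)
  ultimately show ?case
    using Cons.prems(2,3) p by (simp add: edges_of_def inside_decomposition.cycle)
qed

text \<open>
  Two edges lie in the same orbit of a cyclic action iff their keys agree, so only base cycles have
  to be inspected by \<open>code_simp\<close>, which \<open>HOL-Library.Code_Binary_Nat\<close> speeds up considerably.
\<close>

definition edge_orbit :: "nat \<Rightarrow> (nat \<Rightarrow> 'a \<Rightarrow> 'a) \<Rightarrow> 'a set \<Rightarrow> 'a set set" where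
  "edge_orbit k h e = (\<lambda>i. h i ` e) ` {..<k}"

definition orbit_key :: "nat \<Rightarrow> (nat \<Rightarrow> 'a::linorder \<Rightarrow> 'a) \<Rightarrow> 'a set \<Rightarrow> 'a \<times> 'a" where
  "orbit_key k h e = Min ((\<lambda>d. (Min d, Max d)) ` edge_orbit k h e)"

definition valid_certificate ::
  "nat \<Rightarrow> (nat \<Rightarrow> 'a::linorder \<Rightarrow> 'a) \<Rightarrow> ('a list \<times> 'a list) list \<Rightarrow> bool" where
  "valid_certificate k h ps \<longleftrightarrow> (\<forall>(xs, ys)\<in>set ps. inside_pair xs ys) \<and>
     (\<forall>e\<in>set (edges_of (map fst ps)). card (edge_orbit k h e) = k) \<and>
     (let keys = map (orbit_key k h) (edges_of (map fst ps));
          inside_keys = map (orbit_key k h) (edges_of (map snd ps))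
      in distinct keys \<and> distinct inside_keys \<and> set inside_keys \<subseteq> set keys)"

definition cyclic_action :: "nat \<Rightarrow> (nat \<Rightarrow> 'a \<Rightarrow> 'a) \<Rightarrow> bool" where
  "cyclic_action k h \<longleftrightarrow> 0 < k \<and> (\<forall>i j x. h (i + j) x = h i (h j x)) \<and> (\<forall>x. h k x = x)"

lemma cyclic_action_add: "cyclic_action k h \<Longrightarrow> h (i + j) x = h i (h j x)"
  by (simp add: cyclic_action_def)

lemma cyclic_action_mod:
  assumes "cyclic_action k h"
  shows "h (i mod k) x = h i x"
proof -
  have period: "h k x = x" for x using assms by (simp add: cyclic_action_def)
  then have "h 0 x = x" for x using cyclic_action_add[OF assms, of k 0 x] by simp
  then have "h (k * n) x = x" for n
    by (induction n) (simp_all add: cyclic_action_add[OF assms] period)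
  then show ?thesis by (metis cyclic_action_add[OF assms] mod_mult_div_eq)
qed

lemma cyclic_action_inverse:
  assumes "cyclic_action k h"
  shows "h (k - i mod k) (h i x) = x"
proof -
  have "h (k - i mod k) (h i x) = h (k - i mod k + i mod k) x"
    by (simp add: cyclic_action_add[OF assms] cyclic_action_mod[OF assms])
  then show ?thesis using assms by (simp add: cyclic_action_def)
qed

lemma inj_cyclic_action: "cyclic_action k h \<Longrightarrow> inj (h i)"
  using cyclic_action_inverse by (intro inj_on_inverseI)

lemma image_in_edge_orbit:
  assumes "cyclic_action k h"
  shows "h i ` e \<in> edge_orbit k h e"
proof -
  have "h i ` e = h (i mod k) ` e" by (simp add: cyclic_action_mod[OF assms])
  then show ?thesis using assms by (simp add: edge_orbit_def cyclic_action_def)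
qed

lemma edge_orbit_image:
  assumes "cyclic_action k h"
  shows "edge_orbit k h (h i ` e) = edge_orbit k h e"
proof (intro subset_antisym subsetI)
  fix d assume "d \<in> edge_orbit k h (h i ` e)"
  then obtain j where "d = h j ` h i ` e" by (auto simp: edge_orbit_def)
  then have "d = h (j + i) ` e" by (simp add: image_image cyclic_action_add[OF assms])
  then show "d \<in> edge_orbit k h e" by (simp only: image_in_edge_orbit[OF assms])
next
  fix d assume "d \<in> edge_orbit k h e"
  then obtain j where "d = h j ` e" by (auto simp: edge_orbit_def)
  then have "d = h (j + (k - i mod k)) ` h i ` e"
    by (simp add: image_image cyclic_action_add[OF assms] cyclic_action_inverse[OF assms])
  then show "d \<in> edge_orbit k h (h i ` e)" by (simp only: image_in_edge_orbit[OF assms])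
qed

lemma edge_orbit_eqI:
  assumes "cyclic_action k h" "c \<in> edge_orbit k h d" "c \<in> edge_orbit k h e"
  shows "edge_orbit k h d = edge_orbit k h e"
proof -
  obtain i where "c = h i ` d" using assms(2) by (auto simp: edge_orbit_def)
  moreover obtain j where "c = h j ` e" using assms(3) by (auto simp: edge_orbit_def)
  ultimately show ?thesis using edge_orbit_image[OF assms(1)] by metis
qed

lemma card_in_edge_orbit:
  assumes "cyclic_action k h" "d \<in> edge_orbit k h e"
  shows "card d = card e"
  using assms(2) by (auto simp: edge_orbit_def card_image inj_on_subset[OF inj_cyclic_action[OF assms(1)]])

lemma edge_orbit_eq_if_orbit_key_eq:
  fixes d e :: "'a::linorder set"
  assumes action: "cyclic_action k h"
    and "card d = 2" "card e = 2" "orbit_key k h d = orbit_key k h e"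
  shows "edge_orbit k h d = edge_orbit k h e"
proof -
  have key_in: "orbit_key k h c \<in> (\<lambda>c. (Min c, Max c)) ` edge_orbit k h c" for c
    unfolding orbit_key_def using action
    by (intro Min_in) (auto simp: edge_orbit_def cyclic_action_def lessThan_empty_iff)
  obtain d' e' where "d' \<in> edge_orbit k h d" "e' \<in> edge_orbit k h e" "(Min d', Max d') = (Min e', Max e')"
    using key_in[of d] key_in[of e] assms(4) by force
  moreover have "c = {Min c, Max c}" if "card c = 2" for c :: "'a set"
    using that by (auto simp: card_2_iff min_def max_def split: if_splits)
  ultimately have "d' \<in> edge_orbit k h d" "d' \<in> edge_orbit k h e"
    using assms(2,3) card_in_edge_orbit[OF action] by (metis prod.inject)+
  with action show ?thesis by (rule edge_orbit_eqI)
qed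

lemma image_edge_orbit_eq_if_image_orbit_key_eq:
  assumes action: "cyclic_action k h"
    and "orbit_key k h ` G = orbit_key k h ` G'" "\<And>e. e \<in> G \<union> G' \<Longrightarrow> card e = 2"
  shows "edge_orbit k h ` G = edge_orbit k h ` G'"
proof -
  have "edge_orbit k h ` E \<subseteq> edge_orbit k h ` F"
    if keys: "orbit_key k h ` E \<subseteq> orbit_key k h ` F" and card: "\<And>e. e \<in> E \<union> F \<Longrightarrow> card e = 2" for E F
  proof (rule image_subsetI)
    fix e assume "e \<in> E"
    then obtain f where "f \<in> F" "orbit_key k h e = orbit_key k h f" using keys by blast
    then show "edge_orbit k h e \<in> edge_orbit k h ` F"
      using card \<open>e \<in> E\<close> edge_orbit_eq_if_orbit_key_eq[OF action] by (metis UnCI image_eqI)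
  qed
  from this[of G G'] this[of G' G] show ?thesis using assms by blast
qed

lemma card_edge_orbit_certificate:
  assumes "cyclic_action k h" "valid_certificate k h ps"
    and "d \<in> \<Union>(edge_orbit k h ` set (edges_of (map fst ps)))"
  shows "card d = 2"
proof -
  obtain e where "e \<in> set (edges_of (map fst ps @ map snd ps))" "d \<in> edge_orbit k h e"
    using assms(3) by (auto simp: edges_of_def)
  then show ?thesis
    using assms(2) card_in_edge_orbit[OF assms(1)] card_edge_of_inside_pairs
    unfolding valid_certificate_def by metis
qed

lemma Union_edge_orbit: "\<Union>(edge_orbit k h ` G) = (\<Union>i<k. (`) (h i) ` G)"
  by (auto simp: edge_orbit_def)

lemma disjoint_family_translates:
  assumes action: "cyclic_action k h"
    and "\<forall>e\<in>G. card (edge_orbit k h e) = k" "inj_on (edge_orbit k h) G"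
  shows "disjoint_family_on (\<lambda>i. (`) (h i) ` G) {..<k}"
  unfolding disjoint_family_on_def
proof (intro ballI impI, rule ccontr)
  fix i j assume ij: "i \<in> {..<k}" "j \<in> {..<k}" "i \<noteq> j"
  assume "(`) (h i) ` G \<inter> (`) (h j) ` G \<noteq> {}"
  then obtain d e where de: "d \<in> G" "e \<in> G" "h i ` d = h j ` e" by blast
  then have "d = e" using assms(3) edge_orbit_image[OF action] by (metis inj_onD)
  moreover have "inj_on (\<lambda>i. h i ` d) {..<k}"
    using assms(2) de(1) unfolding edge_orbit_def by (intro eq_card_imp_inj_on) auto
  ultimately show False using ij de(3) by (auto dest: inj_onD)
qed

lemma inside_decomposition_orbits:
  assumes action: "cyclic_action k h" and "inside_decomposition G G'"
    and "\<forall>e\<in>G. card (edge_orbit k h e) = k" "inj_on (edge_orbit k h) G"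
    and "\<forall>e\<in>G'. card (edge_orbit k h e) = k" "inj_on (edge_orbit k h) G'"
  shows "inside_decomposition (\<Union>(edge_orbit k h ` G)) (\<Union>(edge_orbit k h ` G'))"
  unfolding Union_edge_orbit
  using assms disjoint_family_translates[OF action]
  by (intro inside_decomposition_UN inside_decomposition_image[OF _ inj_cyclic_action[OF action]]) auto

lemma card_Union_edge_orbit:
  assumes action: "cyclic_action k h"
    and "finite G" "\<forall>e\<in>G. card (edge_orbit k h e) = k" "inj_on (edge_orbit k h) G"
  shows "card (\<Union>(edge_orbit k h ` G)) = k * card G"
proof -
  have "card (\<Union>(edge_orbit k h ` G)) = (\<Sum>i<k. card ((`) (h i) ` G))"
    unfolding Union_edge_orbit using assms disjoint_family_translates[OF action assms(3,4)]
    by (intro card_UN_disjoint) (auto simp: disjoint_family_on_def)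
  also have "\<dots> = (\<Sum>i<k. card G)"
    using inj_cyclic_action[OF action]
    by (intro sum.cong refl card_image inj_on_image) (auto intro: inj_on_subset)
  finally show ?thesis by simp
qed

lemma valid_certificate_imp_image_edge_orbit_eq:
  assumes action: "cyclic_action k h" and "valid_certificate k h ps"
  shows "edge_orbit k h ` set (edges_of (map snd ps)) = edge_orbit k h ` set (edges_of (map fst ps))"
    (is "_ ` set ?ds = _ ` set ?es")
proof -
  have pairs: "\<forall>(xs, ys)\<in>set ps. inside_pair xs ys"
    and distinct: "distinct (map (orbit_key k h) ?es)" "distinct (map (orbit_key k h) ?ds)"
    and subset: "orbit_key k h ` set ?ds \<subseteq> orbit_key k h ` set ?es"
    using assms unfolding valid_certificate_def by (auto simp: Let_def)
  have "card (orbit_key k h ` set ?ds) = card (orbit_key k h ` set ?es)"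
    using distinct[THEN distinct_card] length_edges_of_inside_pairs[OF pairs] by simp
  with subset have "orbit_key k h ` set ?ds = orbit_key k h ` set ?es"
    by (intro card_subset_eq) auto
  with action show ?thesis
  proof (rule image_edge_orbit_eq_if_image_orbit_key_eq)
    show "card e = 2" if "e \<in> set ?ds \<union> set ?es" for e
      using card_edge_of_inside_pairs[OF pairs] that by (auto simp: edges_of_def)
  qed
qed

lemma a2p_packable_certificate:
  assumes action: "cyclic_action k h" and valid: "valid_certificate k h ps"
    and F: "finite F" "\<Union>(edge_orbit k h ` set (edges_of (map fst ps))) \<subseteq> F" "card F = 8 * k * length ps + l"
  shows "a2p_packable F l"
proof -
  let ?es = "edges_of (map fst ps)" and ?ds = "edges_of (map snd ps)"
  note orbits_eq = valid_certificate_imp_image_edge_orbit_eq[OF action valid]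
  have pairs: "\<forall>(xs, ys)\<in>set ps. inside_pair xs ys"
    and full: "\<forall>e\<in>set ?es. card (edge_orbit k h e) = k"
    and "distinct (map (orbit_key k h) ?es)" "distinct (map (orbit_key k h) ?ds)"
    using valid unfolding valid_certificate_def by (auto simp: Let_def)
  then have distinct: "distinct ?es" "distinct ?ds"
    and inj: "inj_on (edge_orbit k h) (set ?es)" "inj_on (edge_orbit k h) (set ?ds)"
    by (auto simp: distinct_map inj_on_def orbit_key_def)
  have "\<forall>e\<in>set ?ds. card (edge_orbit k h e) = k"
    using full orbits_eq by (metis image_iff)
  with full inj have "inside_decomposition (\<Union>(edge_orbit k h ` set ?es)) (\<Union>(edge_orbit k h ` set ?ds))"
    by (intro inside_decomposition_orbits action inside_decomposition_edges_of pairs distinct)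
  then have "inside_decomposition (\<Union>(edge_orbit k h ` set ?es)) (\<Union>(edge_orbit k h ` set ?es))"
    unfolding orbits_eq .
  moreover have "card (\<Union>(edge_orbit k h ` set ?es)) = 8 * k * length ps"
    using card_Union_edge_orbit[OF action _ full inj(1)] distinct_card[OF distinct(1)]
      length_edges_of_inside_pairs(1)[OF pairs] by simp
  ultimately show ?thesis using F by (intro a2p_packable_if_inside_decomposition) auto
qed

definition rotate_blocks :: "nat \<Rightarrow> nat \<Rightarrow> nat \<Rightarrow> nat \<Rightarrow> nat" where
  "rotate_blocks k m i x = (if x < m then k * (x div k) + (x + i) mod k else x)"

lemma cyclic_action_rotate_blocks:
  assumes "0 < k" "k dvd m"
  shows "cyclic_action k (rotate_blocks k m)"
  unfolding cyclic_action_def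
proof (intro conjI allI)
  fix i j x
  show "0 < k" by fact
  show "rotate_blocks k m k x = x" by (simp add: rotate_blocks_def)
  show "rotate_blocks k m (i + j) x = rotate_blocks k m i (rotate_blocks k m j x)"
  proof (cases "x < m")
    case True
    define y where "y = k * (x div k) + (x + j) mod k"
    obtain n where "m = k * n" using assms(2) by (rule dvdE)
    then have "x div k < n" using True by (simp add: less_mult_imp_div_less mult.commute)
    then have "k * (x div k + 1) \<le> k * n" by (intro mult_le_mono2) simp
    moreover have "(x + j) mod k < k" using assms(1) by simp
    ultimately have "y < m" by (simp add: y_def \<open>m = k * n\<close>)
    moreover have "y div k = x div k" using assms(1) by (simp add: y_def)
    moreover have "(y + i) mod k = (x + (i + j)) mod k"
      unfolding y_def add.assoc mod_mult_self4 by (simp add: mod_simps add_ac)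
    ultimately show ?thesis using True by (simp add: rotate_blocks_def y_def)
  qed (simp add: rotate_blocks_def)
qed

lemma a2p_packable_complete_Diff_certificate:
  fixes n r :: nat
  assumes "0 < k" "k dvd m" "valid_certificate k (rotate_blocks k m) ps"
    and vertices: "\<forall>e\<in>set (edges_of (map fst ps)). \<forall>d\<in>edge_orbit k (rotate_blocks k m) e.
      (\<forall>x\<in>d. x < n) \<and> (\<exists>x\<in>d. r \<le> x)"
    and "r \<le> n" "8 * k * length ps + l + (r choose 2) = n choose 2"
  shows "a2p_packable (complete_edges {..<n} - complete_edges {..<r}) l"
proof -
  note action = cyclic_action_rotate_blocks[OF assms(1,2)]
  show ?thesis
  proof (rule a2p_packable_certificate[OF action assms(3)])
    show "finite (complete_edges {..<n} - complete_edges {..<r})" by (simp add: finite_complete_edges)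
    show "card (complete_edges {..<n} - complete_edges {..<r}) = 8 * k * length ps + l"
      using assms(5,6)
      by (subst card_Diff_subset) (simp_all add: finite_complete_edges card_complete_edges complete_edges_mono)
    show "\<Union>(edge_orbit k (rotate_blocks k m) ` set (edges_of (map fst ps)))
      \<subseteq> complete_edges {..<n} - complete_edges {..<r}"
    proof
      fix d assume "d \<in> \<Union>(edge_orbit k (rotate_blocks k m) ` set (edges_of (map fst ps)))"
      then have "card d = 2" "\<forall>x\<in>d. x < n" "\<exists>x\<in>d. r \<le> x"
        using card_edge_orbit_certificate[OF action assms(3)] vertices by auto
      then show "d \<in> complete_edges {..<n} - complete_edges {..<r}"
        by (auto simp: complete_edges_def)
    qed
  qed
qed

lemma a2p_packable_complete_certificate:
  fixes n :: nat
  assumes "0 < k" "k dvd m" "valid_certificate k (rotate_blocks k m) ps"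
    and "\<forall>e\<in>set (edges_of (map fst ps)). \<forall>d\<in>edge_orbit k (rotate_blocks k m) e. \<forall>x\<in>d. x < n"
    and "8 * k * length ps + l = n choose 2"
  shows "a2p_packable (complete_edges {..<n}) l"
proof -
  note action = cyclic_action_rotate_blocks[OF assms(1,2)]
  have "\<exists>x\<in>d. 0 \<le> x" if "e \<in> set (edges_of (map fst ps))" "d \<in> edge_orbit k (rotate_blocks k m) e" for d e
    using card_edge_orbit_certificate[OF action assms(3), of d] that by (auto simp: card_2_iff)
  then have "a2p_packable (complete_edges {..<n} - complete_edges {..<0}) l"
    using assms by (intro a2p_packable_complete_Diff_certificate[of k m ps]) simp_all
  then show ?thesis by simp
qed

section \<open>Explicit packings\<close>

lemma a2p_packable_complete_8: "a2p_packable (complete_edges {..<8::nat}) 4"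
  by (rule a2p_packable_complete_certificate[where k = 3 and m = 6 and ps = "[
      ([4, 0, 1, 3, 5, 7, 2, 6], [4, 2, 1, 5, 6, 0, 7, 3])]"]) code_simp+

lemma a2p_packable_complete_9: "a2p_packable (complete_edges {..<9::nat}) 4"
  by (rule a2p_packable_complete_certificate[where k = 1 and m = 0 and ps = "[
      ([7, 1, 3, 8, 5, 6, 2, 4], [7, 3, 6, 8, 4, 1, 5, 2]),
      ([3, 6, 0, 8, 7, 2, 5, 4], [3, 8, 2, 0, 4, 6, 7, 5]),
      ([8, 2, 0, 5, 7, 6, 1, 4], [8, 5, 4, 2, 6, 0, 7, 1]),
      ([8, 6, 4, 0, 7, 3, 5, 1], [8, 0, 5, 6, 1, 3, 4, 7])]"]) code_simp+

lemma a2p_packable_complete_10: "a2p_packable (complete_edges {..<10::nat}) 5"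
  by (rule a2p_packable_complete_certificate[where k = 5 and m = 10 and ps = "[
      ([8, 1, 3, 7, 4, 0, 5, 6], [3, 0, 8, 7, 5, 1, 6, 4])]"]) code_simp+

lemma a2p_packable_complete_11: "a2p_packable (complete_edges {..<11::nat}) 7"
  by (rule a2p_packable_complete_certificate[where k = 3 and m = 9 and ps = "[
      ([8, 5, 2, 3, 1, 7, 0, 10], [8, 0, 2, 10, 7, 3, 5, 1]),
      ([2, 7, 3, 4, 6, 8, 9, 0], [2, 4, 7, 8, 3, 0, 6, 9])]"]) code_simp+

lemma a2p_packable_complete_13: "a2p_packable (complete_edges {..<13::nat}) 6"
  by (rule a2p_packable_complete_certificate[where k = 3 and m = 12 and ps = "[
      ([1, 6, 0, 3, 12, 9, 11, 2], [11, 0, 1, 3, 9, 2, 6, 12]),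
      ([1, 12, 6, 7, 0, 4, 3, 11], [6, 11, 4, 12, 0, 3, 7, 1]),
      ([9, 8, 10, 4, 11, 0, 5, 6], [9, 0, 4, 5, 10, 6, 8, 11])]"]) code_simp+

lemma a2p_packable_complete_17: "a2p_packable (complete_edges {..<17::nat}) 0"
  by (rule a2p_packable_complete_certificate[where k = 17 and m = 17 and ps = "[
      ([2, 8, 0, 15, 5, 9, 4, 1], [4, 2, 5, 0, 1, 9, 15, 8])]"]) code_simp+

lemma a2p_packable_complete_19: "a2p_packable (complete_edges {..<19::nat}) 3"
  by (rule a2p_packable_complete_certificate[where k = 3 and m = 18 and ps = "[
      ([13, 11, 5, 1, 10, 14, 17, 0], [13, 5, 17, 10, 11, 0, 14, 1]),
      ([5, 3, 12, 1, 4, 2, 17, 16], [5, 12, 16, 1, 17, 4, 3, 2]),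
      ([13, 7, 18, 9, 4, 8, 0, 12], [13, 18, 4, 7, 0, 9, 12, 8]),
      ([10, 13, 8, 17, 4, 16, 14, 3], [10, 4, 13, 14, 8, 3, 17, 16]),
      ([1, 18, 3, 13, 6, 16, 11, 7], [1, 3, 7, 6, 18, 16, 13, 11]),
      ([15, 9, 7, 0, 10, 17, 13, 18], [15, 7, 10, 18, 0, 17, 9, 13]),
      ([8, 11, 9, 1, 17, 6, 4, 7], [8, 9, 4, 11, 6, 1, 7, 17])]"]) code_simp+

lemma a2p_packable_complete_11_Diff_5:
  "a2p_packable (complete_edges {..<11::nat} - complete_edges {..<5}) 5"
  by (rule a2p_packable_complete_Diff_certificate[where k = 5 and m = 10 and ps = "[
      ([6, 3, 5, 4, 8, 9, 10, 1], [10, 8, 3, 9, 1, 5, 6, 4])]"]) code_simp+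

definition complete_bipartite :: "nat \<Rightarrow> nat \<Rightarrow> nat set set" where
  "complete_bipartite p q = bipartite_edges {..<p} {p..<p + q}"

lemma a2p_packable_complete_bipartite_certificate:
  assumes "0 < k" "k dvd m" "valid_certificate k (rotate_blocks k m) ps"
    and vertices: "\<forall>e\<in>set (edges_of (map fst ps)). \<forall>d\<in>edge_orbit k (rotate_blocks k m) e.
      (\<forall>x\<in>d. x < p + q) \<and> (\<exists>x\<in>d. x < p) \<and> (\<exists>x\<in>d. p \<le> x)"
    and "8 * k * length ps = p * q"
  shows "a2p_packable (complete_bipartite p q) 0"
proof -
  note action = cyclic_action_rotate_blocks[OF assms(1,2)]
  show ?thesis
  proof (rule a2p_packable_certificate[OF action assms(3)])
    show "finite (complete_bipartite p q)" by (simp add: complete_bipartite_def bipartite_edges_def)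
    show "card (complete_bipartite p q) = 8 * k * length ps + 0"
      using assms(5) unfolding complete_bipartite_def by (subst card_bipartite_edges) auto
    show "\<Union>(edge_orbit k (rotate_blocks k m) ` set (edges_of (map fst ps))) \<subseteq> complete_bipartite p q"
    proof
      fix d assume "d \<in> \<Union>(edge_orbit k (rotate_blocks k m) ` set (edges_of (map fst ps)))"
      then have d: "card d = 2" "\<forall>x\<in>d. x < p + q" "\<exists>x\<in>d. x < p" "\<exists>x\<in>d. p \<le> x"
        using card_edge_orbit_certificate[OF action assms(3)] vertices by auto
      then obtain a b where "d = {a, b}" by (auto simp: card_2_iff)
      then show "d \<in> complete_bipartite p q"
        using d by (auto simp: complete_bipartite_def doubleton_in_bipartite_edges)
    qed
  qed
qed

lemma a2p_packable_complete_bipartite_4_4: "a2p_packable (complete_bipartite 4 4) 0"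
  by (rule a2p_packable_complete_bipartite_certificate[where k = 2 and m = 4 and ps = "[
      ([4, 0, 5, 2, 6, 1, 7, 3], [4, 1, 5, 3, 6, 0, 7, 2])]"]) code_simp+

lemma a2p_packable_complete_bipartite_6_4: "a2p_packable (complete_bipartite 6 4) 0"
  by (rule a2p_packable_complete_bipartite_certificate[where k = 3 and m = 6 and ps = "[
      ([6, 0, 7, 3, 8, 1, 9, 4], [6, 1, 7, 4, 8, 0, 9, 3])]"]) code_simp+

section \<open>Recursive constructions\<close>

lemma a2p_packable_bipartite_edges_cong_card:
  assumes "a2p_packable (bipartite_edges A B) l" and AB: "A \<inter> B = {}" and A'B': "A' \<inter> B' = {}"
    and "finite A" "finite A'" "card A = card A'" "finite B" "finite B'" "card B = card B'"
  shows "a2p_packable (bipartite_edges A' B') l"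
proof -
  obtain f g where f: "bij_betw f A A'" and g: "bij_betw g B B'"
    using assms(4-9) by (metis finite_same_card_bij)
  define h where "h x = (if x \<in> A then f x else g x)" for x
  have "bij_betw h A A'" using f by (simp add: h_def cong: bij_betw_cong)
  moreover have "bij_betw h B B'"
    using g AB by (subst bij_betw_cong[of B h g]) (auto simp: h_def)
  ultimately have h: "inj_on h (A \<union> B)" "h ` A = A'" "h ` B = B'"
    using bij_betw_combine[OF _ _ A'B'] by (auto simp: bij_betw_def)
  have "\<Union>(bipartite_edges A B) \<subseteq> A \<union> B" by (auto elim!: in_bipartite_edgesE)
  then have "a2p_packable ((`) h ` bipartite_edges A B) l"
    using assms(1) h(1) by (intro a2p_packable_image) (auto intro: inj_on_subset)
  then show ?thesis by (simp add: bipartite_edges_image h(2,3))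
qed

lemma a2p_packable_complete_bipartite_commute:
  assumes "a2p_packable (complete_bipartite p q) l"
  shows "a2p_packable (complete_bipartite q p) l"
proof -
  have "a2p_packable (bipartite_edges {q..<q + p} {..<q}) l"
    using assms unfolding complete_bipartite_def
    by (rule a2p_packable_bipartite_edges_cong_card) auto
  then show ?thesis unfolding complete_bipartite_def by (simp add: bipartite_edges_commute)
qed

lemma a2p_packable_complete_bipartite_add:
  assumes "a2p_packable (complete_bipartite p q) l" "a2p_packable (complete_bipartite p s) m"
  shows "a2p_packable (complete_bipartite p (q + s)) (l + m)"
proof -
  have "a2p_packable (bipartite_edges {..<p} {p + q..<p + q + s}) m"
    using assms(2) unfolding complete_bipartite_def
    by (rule a2p_packable_bipartite_edges_cong_card) auto
  moreover have "bipartite_edges {..<p} {p..<p + q} \<inter> bipartite_edges {..<p} {p + q..<p + q + s} = {}"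
    by (auto elim!: in_bipartite_edgesE simp: doubleton_eq_iff)
  moreover have "{p..<p + (q + s)} = {p..<p + q} \<union> {p + q..<p + q + s}" by auto
  ultimately show ?thesis
    using assms(1) unfolding complete_bipartite_def
    by (simp add: bipartite_edges_Un_right a2p_packable_Un)
qed

lemma a2p_packable_complete_bipartite_even_4:
  assumes "even p" "4 \<le> p"
  shows "a2p_packable (complete_bipartite p 4) 0"
  using assms
proof (induction p rule: less_induct)
  case (less p)
  consider "p = 4" | "p = 6" | "8 \<le> p" using less.prems by atomize_elim presburger
  then show ?case
  proof cases
    assume "8 \<le> p"
    then have "a2p_packable (complete_bipartite 4 (p - 4)) 0"
      using less by (intro a2p_packable_complete_bipartite_commute[OF less.IH]) auto
    then have "a2p_packable (complete_bipartite 4 (p - 4 + 4)) (0 + 0)"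
      using a2p_packable_complete_bipartite_4_4 by (rule a2p_packable_complete_bipartite_add)
    then show ?thesis using \<open>8 \<le> p\<close> by (simp add: a2p_packable_complete_bipartite_commute)
  qed (simp_all add: a2p_packable_complete_bipartite_4_4 a2p_packable_complete_bipartite_6_4)
qed

lemma a2p_packable_complete_bipartite_even_mult_4:
  assumes "even p" "4 \<le> p"
  shows "a2p_packable (complete_bipartite p (4 * s)) 0"
proof (induction s)
  case 0
  show ?case
    using a2p_packable_card[of "{}"] by (simp add: complete_bipartite_def bipartite_edges_def)
next
  case (Suc s)
  then show ?case
    using a2p_packable_complete_bipartite_add[OF a2p_packable_complete_bipartite_even_4[OF assms] Suc]
    by simp
qed

lemma a2p_packable_complete_bipartite:
  assumes "even p" "even q" "4 \<le> p" "4 \<le> q" "8 dvd p * q"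
  shows "a2p_packable (complete_bipartite p q) 0"
proof -
  obtain a b where "p = 2 * a" "q = 2 * b" using assms(1,2) by (auto elim!: evenE)
  then have "even (a * b)" using assms(5) by (auto simp: dvd_def)
  then consider "4 dvd p" | "4 dvd q" using \<open>p = 2 * a\<close> \<open>q = 2 * b\<close> by auto
  then show ?thesis
    using assms a2p_packable_complete_bipartite_even_mult_4 a2p_packable_complete_bipartite_commute
    by cases (metis dvdE)+
qed

lemma a2p_packable_complete_extend:
  fixes p q r :: nat
  assumes "a2p_packable (complete_edges {..<r + p}) l"
    and Y: "a2p_packable (complete_edges {..<r + q} - complete_edges {..<r}) m"
    and pq: "even p" "even q" "4 \<le> p" "4 \<le> q" "8 dvd p * q"
  shows "a2p_packable (complete_edges {..<r + p + q}) (l + m)"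
proof -
  define h where "h x = (if x < r then x else x + p)" for x
  let ?X = "{..<r + p}" and ?Y = "h ` {..<r + q}"
  have h: "inj_on h A" for A by (auto simp: inj_on_def h_def)
  have Y_eq: "?Y = {..<r} \<union> {r + p..<r + p + q}"
  proof -
    have "{..<r + q} = {..<r} \<union> {r..<r + q}" by auto
    moreover have "h ` {..<r} = {..<r}" by (simp add: h_def)
    moreover have "h ` {r..<r + q} = (\<lambda>x. x + p) ` {r..<r + q}" by (simp add: h_def)
    ultimately show ?thesis by (simp add: image_Un add_ac)
  qed
  have sets: "?X \<inter> ?Y = h ` {..<r}" "?X - ?Y = {r..<r + p}" "?Y - ?X = {r + p..<r + p + q}"
    "?X \<union> ?Y = {..<r + p + q}"
    unfolding Y_eq by (auto simp: h_def)
  have "a2p_packable ((`) h ` (complete_edges {..<r + q} - complete_edges {..<r})) m"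
    using Y h by (rule a2p_packable_image)
  then have "a2p_packable (complete_edges ?Y - complete_edges (?X \<inter> ?Y)) m"
    unfolding sets(1) by (simp add: image_set_diff complete_edges_image h inj_on_image)
  moreover have "a2p_packable (bipartite_edges (?X - ?Y) (?Y - ?X)) 0"
    using a2p_packable_complete_bipartite[OF pq] unfolding sets complete_bipartite_def
    by (rule a2p_packable_bipartite_edges_cong_card) auto
  ultimately show ?thesis
    using a2p_packable_complete_edges_Un[OF assms(1), of ?Y m] sets(4) by simp
qed

lemma a2p_packable_complete_add_even:
  fixes n q :: nat
  assumes "a2p_packable (complete_edges {..<n}) l" "a2p_packable (complete_edges {..<q}) m"
    and "even n" "even q" "4 \<le> n" "4 \<le> q" "8 dvd n * q"
  shows "a2p_packable (complete_edges {..<n + q}) (l + m)"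
  using a2p_packable_complete_extend[of 0 n l q m] assms by simp

lemma a2p_packable_complete_add_odd:
  fixes n q :: nat
  assumes "a2p_packable (complete_edges {..<n}) l" "a2p_packable (complete_edges {..<Suc q}) m"
    and "odd n" "8 dvd q" "5 \<le> n" "0 < q"
  shows "a2p_packable (complete_edges {..<n + q}) (l + m)"
proof -
  have "even q" "8 \<le> q" using assms(4,6) by (auto dest: dvd_imp_le)
  moreover have "{..<Suc 0} = {0}" by auto
  ultimately show ?thesis
    using a2p_packable_complete_extend[of 1 "n - 1" l q m] assms by simp
qed

lemma a2p_packable_complete_add_mult_8:
  assumes "a2p_packable (complete_edges {..<n::nat}) l" "even n" "4 \<le> n"
  shows "a2p_packable (complete_edges {..<n + 8 * j}) (l + 4 * j)"
proof (induction j)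
  case 0
  show ?case using assms(1) by simp
next
  case (Suc j)
  have "a2p_packable (complete_edges {..<n + 8 * j + 8}) (l + 4 * j + 4)"
    using assms(2,3) by (intro a2p_packable_complete_add_even[OF Suc a2p_packable_complete_8]) auto
  then show ?case by (simp add: add_ac)
qed

lemma a2p_packable_complete_add_mult_16:
  assumes "a2p_packable (complete_edges {..<n::nat}) l" "odd n" "5 \<le> n"
  shows "a2p_packable (complete_edges {..<n + 16 * j}) l"
proof (induction j)
  case 0
  show ?case using assms(1) by simp
next
  case (Suc j)
  have "a2p_packable (complete_edges {..<n + 16 * j + 16}) (l + 0)"
    using assms(2,3) a2p_packable_complete_17
    by (intro a2p_packable_complete_add_odd[OF Suc]) auto
  then show ?case by (simp add: add_ac)
qed

lemma a2p_packable_complete_4: "a2p_packable (complete_edges {..<4::nat}) 6"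
  using a2p_packable_card[of "complete_edges {..<4::nat}"]
  by (simp add: finite_complete_edges card_complete_edges choose_two)

lemma a2p_packable_complete_12: "a2p_packable (complete_edges {..<12::nat}) 10"
  using a2p_packable_complete_add_even[OF a2p_packable_complete_8 a2p_packable_complete_4] by simp

lemma a2p_packable_complete_14: "a2p_packable (complete_edges {..<14::nat}) 11"
  using a2p_packable_complete_add_even[OF a2p_packable_complete_10 a2p_packable_complete_4] by simp

lemma a2p_packable_complete_15: "a2p_packable (complete_edges {..<15::nat}) 9"
  using a2p_packable_complete_extend[of 5 4 4 6 5] a2p_packable_complete_9
    a2p_packable_complete_11_Diff_5 by simp

lemma a2p_packable_complete_21: "a2p_packable (complete_edges {..<21::nat}) 10"
  using a2p_packable_complete_add_odd[OF a2p_packable_complete_13, of 8 4] a2p_packable_complete_9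
  by simp

lemma a2p_packable_complete_23: "a2p_packable (complete_edges {..<23::nat}) 5"
  using a2p_packable_complete_extend[of 5 12 0 6 5] a2p_packable_complete_17
    a2p_packable_complete_11_Diff_5 by simp

lemma a2p_packable_complete_even:
  fixes n :: nat
  assumes "even n" "8 \<le> n"
  shows "\<exists>l. a2p_packable (complete_edges {..<n}) l \<and> 2 * l < n + 16"
proof -
  define r where "r = 8 + (n - 8) mod 8"
  define j where "j = (n - 8) div 8"
  have n: "n = r + 8 * j" using assms(2) by (simp add: r_def j_def)
  then have "even r" using assms(1) by simp
  moreover have "8 \<le> r" "r < 16" by (simp_all add: r_def)
  ultimately consider "r = 8" | "r = 10" | "r = 12" | "r = 14" by atomize_elim presburger
  then have "\<exists>l. a2p_packable (complete_edges {..<r}) l \<and> 2 * l < r + 16"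
    using a2p_packable_complete_8 a2p_packable_complete_10
      a2p_packable_complete_12 a2p_packable_complete_14 by cases (force intro: exI)+
  then obtain l where "a2p_packable (complete_edges {..<r}) l" "2 * l < r + 16" by blast
  then have "a2p_packable (complete_edges {..<n}) (l + 4 * j)" "2 * (l + 4 * j) < n + 16"
    unfolding n using \<open>even r\<close> \<open>8 \<le> r\<close> by (auto intro: a2p_packable_complete_add_mult_8)
  then show ?thesis by blast
qed

lemma a2p_packable_complete_odd:
  fixes n :: nat
  assumes "odd n" "8 \<le> n"
  shows "\<exists>l. a2p_packable (complete_edges {..<n}) l \<and> l \<le> 10 \<and> l \<noteq> 8"
proof -
  define r where "r = 8 + (n - 8) mod 16"
  define j where "j = (n - 8) div 16"
  have n: "n = r + 16 * j" using assms(2) by (simp add: r_def j_def)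
  then have "odd r" using assms(1) by simp
  moreover have "8 \<le> r" "r < 24" by (simp_all add: r_def)
  ultimately consider "r = 9" | "r = 11" | "r = 13" | "r = 15" | "r = 17" | "r = 19" | "r = 21" | "r = 23"
    by atomize_elim presburger
  then have "\<exists>l. a2p_packable (complete_edges {..<r}) l \<and> l \<le> 10 \<and> l \<noteq> 8"
    using a2p_packable_complete_9 a2p_packable_complete_11 a2p_packable_complete_13
      a2p_packable_complete_15 a2p_packable_complete_17 a2p_packable_complete_19
      a2p_packable_complete_21 a2p_packable_complete_23 by cases (force intro: exI)+
  then obtain l where "a2p_packable (complete_edges {..<r}) l" and l: "l \<le> 10" "l \<noteq> 8" by blast
  then have "a2p_packable (complete_edges {..<n}) l"
    unfolding n using \<open>odd r\<close> \<open>8 \<le> r\<close> by (intro a2p_packable_complete_add_mult_16) auto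
  then show ?thesis using l by blast
qed

section \<open>Lower bounds for the leave\<close>

definition degree :: "'a set set \<Rightarrow> 'a \<Rightarrow> nat" where
  "degree G x = card {e \<in> G. x \<in> e}"

lemma degree_Un:
  assumes "finite G" "finite H" "G \<inter> H = {}"
  shows "degree (G \<union> H) x = degree G x + degree H x"
proof -
  have "{e \<in> G \<union> H. x \<in> e} = {e \<in> G. x \<in> e} \<union> {e \<in> H. x \<in> e}" by blast
  then show ?thesis
    unfolding degree_def using assms by (simp only:) (intro card_Un_disjoint; auto)
qed

lemma even_degree_Union:
  assumes "finite CC" "pairwise disjnt CC" "\<And>C. C \<in> CC \<Longrightarrow> finite C \<and> even (degree C x)"
  shows "even (degree (\<Union>CC) x)"
  using assms
proof (induction CC)
  case empty
  show ?case by (simp add: degree_def)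
next
  case (insert C CC)
  then have "degree (C \<union> \<Union>CC) x = degree C x + degree (\<Union>CC) x"
    by (intro degree_Un) (auto simp: pairwise_insert disjnt_def)
  then show ?case using insert by (simp add: pairwise_insert)
qed

lemma degree_complete_edges:
  assumes "finite X" "x \<in> X"
  shows "degree (complete_edges X) x = card X - 1"
proof -
  have "{e \<in> complete_edges X. x \<in> e} = (\<lambda>y. {x, y}) ` (X - {x})"
    using assms(2) by (auto elim!: in_complete_edgesE simp: doubleton_in_complete_edges)
  moreover have "inj_on (\<lambda>y. {x, y}) (X - {x})" by (auto simp: inj_on_def doubleton_eq_iff)
  ultimately show ?thesis using assms by (simp add: degree_def card_image)
qed

lemma inj_on_cycle_edge:
  assumes "inj_on v {..<8}"
  shows "inj_on (\<lambda>i. {v i, v ((i + 1) mod 8)}) {..<8::nat}"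
proof (rule inj_onI)
  fix i j :: nat
  assume ij: "i \<in> {..<8}" "j \<in> {..<8}" "{v i, v ((i + 1) mod 8)} = {v j, v ((j + 1) mod 8)}"
  then have "i = j \<or> i = (j + 1) mod 8 \<and> (i + 1) mod 8 = j"
    using assms by (auto simp: doubleton_eq_iff inj_on_def)
  then show "i = j" using ij(1,2) by (auto simp: mod_Suc split: if_splits)
qed

lemma card_8cycle:
  assumes "is_8cycle C"
  shows "card C = 8"
proof -
  obtain v where "inj_on v {..<8}" "C = (\<lambda>i. {v i, v ((i + 1) mod 8)}) ` {..<8::nat}"
    using assms by (rule is_8cycleE)
  then show ?thesis using card_image[OF inj_on_cycle_edge] by force
qed

lemma even_degree_8cycle:
  assumes "is_8cycle C"
  shows "even (degree C x)"
proof -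
  obtain v where v: "inj_on v {..<8}" and C: "C = (\<lambda>i. {v i, v ((i + 1) mod 8)}) ` {..<8::nat}"
    using assms by (rule is_8cycleE)
  define E where "E i = {v i, v ((i + 1) mod 8)}" for i
  have cyclic_shift: "(\<Sum>i<8. g ((i + 1) mod 8)) = (\<Sum>i<8. g i)" for g :: "nat \<Rightarrow> nat"
    by (rule sum.reindex_bij_witness[where i = "\<lambda>i. (i + 7) mod 8" and j = "\<lambda>i. (i + 1) mod 8"])
      (auto simp: mod_simps)
  have v_neq: "v ((i + 1) mod 8) \<noteq> v i" if "i < 8" for i
    using inj_onD[OF v, of i "(i + 1) mod 8"] that by (auto simp: mod_Suc split: if_splits)
  have "{e \<in> C. x \<in> e} = E ` {i \<in> {..<8}. x \<in> E i}" unfolding C E_def by auto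
  moreover have "inj_on E {i \<in> {..<8}. x \<in> E i}"
    using inj_on_cycle_edge[OF v] unfolding E_def by (rule inj_on_subset) auto
  ultimately have "degree C x = (\<Sum>i<8. of_bool (x \<in> E i))"
    by (simp add: degree_def card_image Int_def flip: sum.inter_filter)
  also have "\<dots> = (\<Sum>i<8. of_bool (x = v i) + of_bool (x = v ((i + 1) mod 8)))"
    using v_neq by (intro sum.cong) (force simp: E_def)+
  also have "\<dots> = 2 * (\<Sum>i<8. of_bool (x = v i))"
    unfolding sum.distrib by (subst cyclic_shift) simp
  finally show ?thesis by simp
qed

lemma even_degrees_imp_3_le_card:
  assumes "finite G" "G \<noteq> {}" and edge: "\<And>e. e \<in> G \<Longrightarrow> card e = 2"
    and degree: "\<And>x. x \<in> \<Union>G \<Longrightarrow> even (degree G x)"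
  shows "3 \<le> card G"
proof -
  have other_edge: "\<exists>d\<in>G. x \<in> d \<and> d \<noteq> e" if "e \<in> G" "x \<in> e" for e x
  proof (rule ccontr)
    assume "\<not> ?thesis"
    then have "{d \<in> G. x \<in> d} = {e}" using that by blast
    then show False using degree[of x] that by (auto simp: degree_def)
  qed
  obtain e where e: "e \<in> G" using assms(2) by blast
  then obtain a b where ab: "e = {a, b}" "a \<noteq> b" using edge by (meson card_2_iff)
  obtain d where d: "d \<in> G" "a \<in> d" "d \<noteq> e" using other_edge e ab by blast
  obtain d' where d': "d' \<in> G" "b \<in> d'" "d' \<noteq> e" using other_edge e ab by blast
  have "d \<noteq> d'"
  proof
    assume "d = d'"
    then have "e \<subseteq> d" using ab d d' by blast
    then show False using edge d(1,3) e by (metis card.infinite card_subset_eq zero_neq_numeral)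
  qed
  then have "card {e, d, d'} = 3" using d(3) d'(3) by auto
  moreover have "{e, d, d'} \<subseteq> G" using e d(1) d'(1) by blast
  ultimately show ?thesis using assms(1) by (metis card_mono)
qed

lemma odd_degrees_imp_card_le:
  assumes "finite G" and edge: "\<And>e. e \<in> G \<Longrightarrow> card e = 2"
    and degree: "\<And>x. x \<in> X \<Longrightarrow> odd (degree G x)"
  shows "card X \<le> 2 * card G"
proof -
  have "X \<subseteq> \<Union>G"
  proof
    fix x assume "x \<in> X"
    then have "{e \<in> G. x \<in> e} \<noteq> {}" using degree unfolding degree_def by (metis card.empty even_zero)
    then show "x \<in> \<Union>G" by blast
  qed
  moreover have "finite (\<Union>G)" using assms(1) edge by (metis card.infinite finite_Union zero_neq_numeral)
  ultimately have "card X \<le> card (\<Union>G)" by (simp add: card_mono)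
  also have "\<dots> \<le> (\<Sum>e\<in>G. card e)" by (rule card_Union_le_sum_card)
  also have "\<dots> = 2 * card G" using edge by simp
  finally show ?thesis .
qed

lemma packing_is_8cycle: "is_8cycle_packing X CC L \<Longrightarrow> C \<in> CC \<Longrightarrow> is_8cycle C"
  unfolding is_8cycle_packing_def by blast

lemma packing_disjoint: "is_8cycle_packing X CC L \<Longrightarrow> pairwise disjnt CC"
  unfolding is_8cycle_packing_def by (simp add: pairwise_def disjnt_def)

lemma packing_complete_edges_eq: "is_8cycle_packing X CC L \<Longrightarrow> complete_edges X = L \<union> \<Union>CC"
  unfolding is_8cycle_packing_def by blast

lemma packing_leave_disjoint: "is_8cycle_packing X CC L \<Longrightarrow> L \<inter> \<Union>CC = {}"
  unfolding is_8cycle_packing_def by blast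

lemma packing_leave_subset: "is_8cycle_packing X CC L \<Longrightarrow> L \<subseteq> complete_edges X"
  unfolding is_8cycle_packing_def by blast

lemma packing_finite:
  assumes "is_8cycle_packing X CC L" "finite X"
  shows "finite CC" "finite L" "\<And>C. C \<in> CC \<Longrightarrow> finite C"
proof -
  have "finite (L \<union> \<Union>CC)"
    using finite_complete_edges[OF assms(2)] packing_complete_edges_eq[OF assms(1)] by simp
  then show "finite CC" "finite L" "\<And>C. C \<in> CC \<Longrightarrow> finite C"
    using finite_UnionD by (auto intro: finite_subset)
qed

lemma card_complete_edges_packing:
  assumes packing: "is_8cycle_packing X CC L" and "finite X"
  shows "card (complete_edges X) = card L + 8 * card CC"
proof -
  note finite = packing_finite[OF assms]
  have "card (\<Union>CC) = (\<Sum>C\<in>CC. card C)"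
    using packing_disjoint[OF packing] finite(3) by (rule card_Union_disjoint)
  also have "\<dots> = 8 * card CC"
    using packing_is_8cycle[OF packing] by (simp add: card_8cycle)
  finally show ?thesis
    unfolding packing_complete_edges_eq[OF packing]
    using finite packing_leave_disjoint[OF packing] by (subst card_Un_disjoint) auto
qed

lemma even_degree_leave_iff:
  assumes packing: "is_8cycle_packing X CC L" and X: "finite X" "x \<in> X"
  shows "even (degree L x) \<longleftrightarrow> odd (card X)"
proof -
  note finite = packing_finite[OF packing X(1)]
  have "even (degree (\<Union>CC) x)"
    using finite packing_disjoint[OF packing] packing_is_8cycle[OF packing]
    by (intro even_degree_Union) (auto simp: even_degree_8cycle)
  moreover have "card X - 1 = degree L x + degree (\<Union>CC) x"
    unfolding degree_complete_edges[OF X, symmetric] packing_complete_edges_eq[OF packing]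
    using finite packing_leave_disjoint[OF packing] by (intro degree_Un) auto
  moreover have "card X > 0" using X by (auto simp: card_gt_0_iff)
  ultimately show ?thesis by presburger
qed

lemma card_le_2_card_leave:
  assumes packing: "is_8cycle_packing X CC L" and X: "finite X" "even (card X)"
  shows "card X \<le> 2 * card L"
proof (rule odd_degrees_imp_card_le)
  show "finite L" using packing X(1) by (rule packing_finite)
  show "card e = 2" if "e \<in> L" for e
    using packing_leave_subset[OF packing] that unfolding complete_edges_def by blast
  show "odd (degree L x)" if "x \<in> X" for x
    using even_degree_leave_iff[OF packing X(1) that] X(2) by simp
qed

lemma card_leave_eq_0_or_ge_3:
  assumes packing: "is_8cycle_packing X CC L" and X: "finite X" "odd (card X)"
  shows "card L = 0 \<or> 3 \<le> card L"
proof (cases "L = {}")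
  case False
  have "3 \<le> card L"
  proof (rule even_degrees_imp_3_le_card)
    show "finite L" using packing X(1) by (rule packing_finite)
    show "card e = 2" if "e \<in> L" for e
      using packing_leave_subset[OF packing] that unfolding complete_edges_def by blast
    show "even (degree L x)" if "x \<in> \<Union>L" for x
    proof -
      have "x \<in> X"
        using packing_leave_subset[OF packing] that unfolding complete_edges_def by blast
      then show ?thesis using even_degree_leave_iff[OF packing X(1)] X(2) by simp
    qed
  qed (rule False)
  then show ?thesis ..
qed simp

lemma is_max_8cycle_packing_even:
  assumes packing: "is_8cycle_packing X CC L" and X: "finite X" "even (card X)"
    and small: "2 * card L < card X + 16"
  shows "is_max_8cycle_packing X CC L"
  unfolding is_max_8cycle_packing_def
proof (intro conjI allI impI packing)
  fix CC' L' assume packing': "is_8cycle_packing X CC' L'"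
  have "card L + 8 * card CC = card L' + 8 * card CC'"
    using packing packing' X(1) by (metis card_complete_edges_packing)
  moreover have "card L < card L' + 8"
    using card_le_2_card_leave[OF packing' X] small by simp
  ultimately show "card L \<le> card L'" by presburger
qed

lemma is_max_8cycle_packing_odd:
  assumes packing: "is_8cycle_packing X CC L" and X: "finite X" "odd (card X)"
    and small: "card L \<le> 10" "card L \<noteq> 8"
  shows "is_max_8cycle_packing X CC L"
  unfolding is_max_8cycle_packing_def
proof (intro conjI allI impI packing)
  fix CC' L' assume packing': "is_8cycle_packing X CC' L'"
  have "card L + 8 * card CC = card L' + 8 * card CC'"
    using packing packing' X(1) by (metis card_complete_edges_packing)
  then show "card L \<le> card L'"
    using card_leave_eq_0_or_ge_3[OF packing' X] small by presburger
qed

theorem mainTheorem1: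
  fixes n :: nat
  assumes "n \<ge> 8"
  shows "\<exists>CC L. is_max_8cycle_packing {..<n} CC L \<and> is_A2P {..<n} CC L"
proof -
  obtain l where l: "a2p_packable (complete_edges {..<n}) l"
    and small: "even n \<and> 2 * l < n + 16 \<or> odd n \<and> l \<le> 10 \<and> l \<noteq> 8"
    using a2p_packable_complete_even[OF _ assms] a2p_packable_complete_odd[OF _ assms] by blast
  obtain CC L where CC: "is_A2P {..<n} CC L" and L: "card L = l"
    using l by (rule a2p_packable_imp_is_A2P)
  have "is_8cycle_packing {..<n} CC L" using CC unfolding is_A2P_def by blast
  then have "is_max_8cycle_packing {..<n} CC L"
    using small is_max_8cycle_packing_even is_max_8cycle_packing_odd L by fastforce
  then show ?thesis using CC by blast
qed

end
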